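(* Let $\mathbb{F}$ be $\mathbb{R}$ or $\mathbb{C}$ and let $R(z)\in\mathbb{F}(z)^{m\times m}$ be a nonzero rational matrix. If $R(z)$ is para-Hermitian (resp., para-skew-Hermitian), then there is no $*$-palindromic (resp., $*$-anti-palindromic) linear system matrix whose transfer function is $R(z)$.
   Context: For a rational matrix $R(t)$ with complex coefficients, $R^*(t):=[R(\overline{t})]^*$ (the coefficients are conjugate-transposed, the variable is not conjugated); i.e. $(R^* )_{ij}(t)=\overline{R_{ji}(\overline{t})}$. A square rational matrix $R(z)$ is para-Hermitian if $R^*(z)=R(1/z)$, and para-skew-Hermitian if $R^*(z)=-R(1/z)$. A pencil is a polynomial matrix of the form $L(z)=zL_1+L_0$ with constant matrices $L_1,L_0$. For a rational matrix $H(z)$ put $\mathrm{rev}_1 H(z):=zH(1/z)$. A square pencil $L(z)$ is $*$-palindromic if $\mathrm{rev}_1L^*(z)=L(z)$ (i.e. $L(z)=zL_0^*+L_0$), and $*$-anti-palindromic if $\mathrm{rev}_1L^*(z)=-L(z)$ (i.e. $L_0=-L_1^*$). A linear system matrix is a block-partitioned complex pencil $$L(z)=\begin{bmatrix}-A(z)&B(z)\\ C(z)&D(z)\end{bmatrix}$$ with $A(z)$ a $p\times p$ regular pencil ($\det A(z)\not\equiv0$), $p\ge 0$ (for $p=0$ the blocks $A,B,C$ are empty). Its transfer function is the rational matrix $D(z)+C(z)A(z)^{-1}B(z)$. No minimality is assumed. *)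

theory Defs
  imports
    Complex_Main
    "HOL-Computational_Algebra.Polynomial_Factorial"
    "HOL-Computational_Algebra.Normalized_Fraction"
    "HOL-Computational_Algebra.Field_as_Ring"
    "Jordan_Normal_Form.Determinant"
    "Jordan_Normal_Form.Gauss_Jordan_Elimination"
begin

section \<open>Rational functions of one variable\<close>

type_synonym ratfun = "complex poly fract"

definition ratfun_const :: "complex \<Rightarrow> ratfun" where
  "ratfun_const c = to_fract [:c:]"

definition ratfun_z :: ratfun where
  "ratfun_z = to_fract [:0, 1:]"

text \<open>The set \<open>F(z)\<close> for a subfield \<open>F\<close> of the complex numbers.\<close>

definition ratfuns_over :: "complex set \<Rightarrow> ratfun set" where
  "ratfuns_over F =
     {Fraction_Field.Fract a b | a b. b \<noteq> 0 \<and> (\<forall>i. coeff a i \<in> F) \<and> (\<forall>i. coeff b i \<in> F)}"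

definition poly_subst :: "complex poly \<Rightarrow> ratfun \<Rightarrow> ratfun" where
  "poly_subst p x = poly (map_poly ratfun_const p) x"

lemma ratfun_const_hom [simp]:
  "ratfun_const 0 = 0" "ratfun_const 1 = 1"
  "ratfun_const (c + d) = ratfun_const c + ratfun_const d"
  "ratfun_const (c * d) = ratfun_const c * ratfun_const d"
     apply (simp_all add: ratfun_const_def one_pCons [symmetric])
   apply (simp flip: to_fract_add)
  apply (simp flip: to_fract_mult)
  done

lemma poly_subst_0 [simp]: "poly_subst 0 x = 0"
  by (simp add: poly_subst_def)

lemma poly_subst_pCons [simp]: "poly_subst (pCons c p) x = ratfun_const c + x * poly_subst p x"
  by (simp add: poly_subst_def map_poly_pCons)

lemma poly_subst_add: "poly_subst (p + q) x = poly_subst p x + poly_subst q x"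
  by (induction p q rule: poly_induct2) (simp_all add: algebra_simps)

lemma poly_subst_smult: "poly_subst (smult c p) x = ratfun_const c * poly_subst p x"
  by (induction p) (simp_all add: algebra_simps)

lemma poly_subst_mult: "poly_subst (p * q) x = poly_subst p x * poly_subst q x"
  by (induction p) (simp_all add: poly_subst_add poly_subst_smult algebra_simps)

lemma poly_subst_z: "poly_subst p ratfun_z = to_fract p"
proof (induction p)
  case (pCons c p)
  have "pCons c p = [:c:] + [:0, 1:] * p" by simp
  then show ?case
    using pCons.IH
    by (simp add: ratfun_const_def ratfun_z_def flip: to_fract_add to_fract_mult)
qed simp

lemma ratfun_z_nonzero [simp]: "ratfun_z \<noteq> 0"
  by (simp add: ratfun_z_def)

lemma ratfun_const_eq_0_iff [simp]: "ratfun_const c = 0 \<longleftrightarrow> c = 0"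
  by (simp add: ratfun_const_def)

lemma poly_subst_inverse_z_nonzero:
  assumes "p \<noteq> 0"
  shows "poly_subst p (1 / ratfun_z) \<noteq> 0"
proof -
  have refl: "map_poly ratfun_const (reflect_poly p) = reflect_poly (map_poly ratfun_const p)"
    by (intro poly_eqI) (simp add: coeff_map_poly coeff_reflect_poly degree_map_poly)
  have "to_fract (reflect_poly p) = poly (reflect_poly (map_poly ratfun_const p)) ratfun_z"
    by (simp add: poly_subst_z [symmetric] poly_subst_def refl)
  also have "\<dots> = ratfun_z ^ degree p * poly_subst p (1 / ratfun_z)"
    by (simp add: poly_reflect_poly_nz poly_subst_def degree_map_poly field_simps)
  finally show ?thesis
    using assms by auto
qed

text \<open>\<open>quot_of_fract\<close> picks the normalised representative; by \<open>ratfun_recip_Fract\<close> and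
  \<open>ratfun_cnj_Fract\<close> below the choice of representative does not matter.\<close>

lemma obtain_quot_of_fract:
  fixes a b :: "complex poly"
  assumes "b \<noteq> 0"
  obtains c d where "quot_of_fract (Fraction_Field.Fract a b) = (c, d)" "d \<noteq> 0" "a * d = c * b"
proof -
  obtain c d where cd: "quot_of_fract (Fraction_Field.Fract a b) = (c, d)" by force
  have "d \<noteq> 0"
    using snd_quot_of_fract_nonzero [of "Fraction_Field.Fract a b"] cd by simp
  moreover have "Fraction_Field.Fract a b = Fraction_Field.Fract c d"
    using quot_to_fract_quot_of_fract [of "Fraction_Field.Fract a b"] cd
    by (simp add: quot_to_fract_def)
  ultimately show ?thesis
    using that cd assms by (simp add: eq_fract)
qed

text \<open>\<open>r(1/z)\<close>, obtained by substituting \<open>1/z\<close> in numerator and denominator.\<close>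

definition ratfun_recip :: "ratfun \<Rightarrow> ratfun" where
  "ratfun_recip r =
     (case quot_of_fract r of (a, b) \<Rightarrow>
        poly_subst a (1 / ratfun_z) / poly_subst b (1 / ratfun_z))"

lemma ratfun_recip_Fract:
  assumes "b \<noteq> 0"
  shows "ratfun_recip (Fraction_Field.Fract a b) =
     poly_subst a (1 / ratfun_z) / poly_subst b (1 / ratfun_z)"
proof -
  obtain c d where cd: "quot_of_fract (Fraction_Field.Fract a b) = (c, d)" "d \<noteq> 0"
      "a * d = c * b"
    using obtain_quot_of_fract [OF assms] .
  have "poly_subst a (1 / ratfun_z) * poly_subst d (1 / ratfun_z) =
        poly_subst c (1 / ratfun_z) * poly_subst b (1 / ratfun_z)"
    by (simp only: cd flip: poly_subst_mult)
  with cd(1,2) assms show ?thesis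
    by (simp add: ratfun_recip_def frac_eq_eq poly_subst_inverse_z_nonzero)
qed

text \<open>Conjugation of the coefficients only; as a function, this is \<open>cnj (r (cnj t))\<close>.\<close>

definition ratfun_cnj :: "ratfun \<Rightarrow> ratfun" where
  "ratfun_cnj r =
     (case quot_of_fract r of (a, b) \<Rightarrow> Fraction_Field.Fract (map_poly cnj a) (map_poly cnj b))"

lemma map_poly_cnj_mult: "map_poly cnj (p * q) = map_poly cnj p * map_poly cnj q"
  by (intro poly_eqI) (simp add: coeff_map_poly coeff_mult)

lemma ratfun_cnj_Fract:
  assumes "b \<noteq> 0"
  shows "ratfun_cnj (Fraction_Field.Fract a b) =
     Fraction_Field.Fract (map_poly cnj a) (map_poly cnj b)"
proof -
  obtain c d where cd: "quot_of_fract (Fraction_Field.Fract a b) = (c, d)" "d \<noteq> 0"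
      "a * d = c * b"
    using obtain_quot_of_fract [OF assms] .
  have "map_poly cnj a * map_poly cnj d = map_poly cnj c * map_poly cnj b"
    by (simp only: cd flip: map_poly_cnj_mult)
  with cd(1,2) assms show ?thesis
    by (simp add: ratfun_cnj_def eq_fract map_poly_eq_0_iff)
qed

section \<open>Rational matrices\<close>

definition star :: "ratfun mat \<Rightarrow> ratfun mat" where
  "star R = map_mat ratfun_cnj (transpose_mat R)"

definition mat_recip :: "ratfun mat \<Rightarrow> ratfun mat" where
  "mat_recip R = map_mat ratfun_recip R"

definition para_hermitian :: "ratfun mat \<Rightarrow> bool" where
  "para_hermitian R \<longleftrightarrow> square_mat R \<and> star R = mat_recip R"

definition para_skew_hermitian :: "ratfun mat \<Rightarrow> bool" where
  "para_skew_hermitian R \<longleftrightarrow> square_mat R \<and> star R = - mat_recip R"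

definition rev1 :: "ratfun mat \<Rightarrow> ratfun mat" where
  "rev1 H = ratfun_z \<cdot>\<^sub>m mat_recip H"

section \<open>Pencils and linear system matrices\<close>

definition pencil :: "ratfun mat \<Rightarrow> bool" where
  "pencil L \<longleftrightarrow>
     (\<exists>L1 \<in> carrier_mat (dim_row L) (dim_col L). \<exists>L0 \<in> carrier_mat (dim_row L) (dim_col L).
        L = ratfun_z \<cdot>\<^sub>m map_mat ratfun_const L1 + map_mat ratfun_const L0)"

definition star_palindromic :: "ratfun mat \<Rightarrow> bool" where
  "star_palindromic L \<longleftrightarrow> square_mat L \<and> pencil L \<and> rev1 (star L) = L"

definition star_anti_palindromic :: "ratfun mat \<Rightarrow> bool" where
  "star_anti_palindromic L \<longleftrightarrow> square_mat L \<and> pencil L \<and> rev1 (star L) = - L"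

definition system_matrix ::
  "ratfun mat \<Rightarrow> ratfun mat \<Rightarrow> ratfun mat \<Rightarrow> ratfun mat \<Rightarrow> ratfun mat" where
  "system_matrix A B C D = four_block_mat (- A) B C D"

text \<open>The block partition is part of the data. The state dimension \<open>p\<close> may be \<open>0\<close>: the blocks
  \<open>A\<close>, \<open>B\<close>, \<open>C\<close> are then empty, \<open>det A = 1\<close>, and the system matrix is \<open>D\<close>.\<close>

definition linear_system_matrix ::
  "nat \<Rightarrow> nat \<Rightarrow> nat \<Rightarrow> ratfun mat \<Rightarrow> ratfun mat \<Rightarrow> ratfun mat \<Rightarrow> ratfun mat \<Rightarrow> bool" where
  "linear_system_matrix p q r A B C D \<longleftrightarrow>
     A \<in> carrier_mat p p \<and> B \<in> carrier_mat p r \<and> C \<in> carrier_mat q p \<and> D \<in> carrier_mat q r \<and>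
     pencil (system_matrix A B C D) \<and> det A \<noteq> 0"

text \<open>Only meaningful when \<open>det A \<noteq> 0\<close>, where \<open>mat_inverse A\<close> is not \<open>None\<close>.\<close>

definition transfer_function ::
  "ratfun mat \<Rightarrow> ratfun mat \<Rightarrow> ratfun mat \<Rightarrow> ratfun mat \<Rightarrow> ratfun mat" where
  "transfer_function A B C D = D + C * the (mat_inverse A) * B"

lemma mat_inverse_regular:
  fixes A :: "ratfun mat"
  assumes A: "A \<in> carrier_mat p p" and "det A \<noteq> 0"
  shows "the (mat_inverse A) \<in> carrier_mat p p"
    and "A * the (mat_inverse A) = 1\<^sub>m p" and "the (mat_inverse A) * A = 1\<^sub>m p"
proof -
  have "A \<in> Units (ring_mat TYPE(ratfun) p ())"
    using det_non_zero_imp_unit [OF assms] .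
  with mat_inverse(1) [OF A, where b = "()"] obtain B where "mat_inverse A = Some B"
    by (cases "mat_inverse A") auto
  with mat_inverse(2) [OF A, of B]
  show "the (mat_inverse A) \<in> carrier_mat p p"
    and "A * the (mat_inverse A) = 1\<^sub>m p" and "the (mat_inverse A) * A = 1\<^sub>m p"
    by auto
qed

end

theory Submission
  imports Defs
begin

text \<open>Let \<open>R\<^sup>\<sharp>(z) = R\<^sup>*(1/z)\<close>, an additive, product-reversing involution on rational matrices. A system
  matrix is \<open>*\<close>-(anti-)palindromic iff \<open>L\<^sup>\<sharp> = w L\<close> with \<open>w = \<plusminus>1/z\<close>, and this scaling is inherited
  by the transfer function: \<open>\<sharp>\<close> exchanges the off-diagonal blocks, so that
  \<open>(C A\<^sup>-\<^sup>1 B)\<^sup>\<sharp> = (w C) (w A)\<^sup>-\<^sup>1 (w B) = w C A\<^sup>-\<^sup>1 B\<close>. But a para-(skew-)Hermitian \<open>R\<close>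
  satisfies \<open>R\<^sup>\<sharp> = \<plusminus>R\<close> with the same sign, so \<open>R = R/z\<close>, hence \<open>R = 0\<close>.\<close>

text \<open>Substituting \<open>1 / ratfun_z\<close> respects sums and products of polynomials and
  keeps denominators nonzero, so fractions can be added over a common denominator before or after
  it.\<close>

lemma ratfun_recip_add: "ratfun_recip (r + s) = ratfun_recip r + ratfun_recip s"
  by (cases r; cases s)
    (simp add: ratfun_recip_Fract poly_subst_add poly_subst_mult poly_subst_inverse_z_nonzero
      add_frac_eq mult.commute)

lemma ratfun_recip_mult: "ratfun_recip (r * s) = ratfun_recip r * ratfun_recip s"
  by (cases r; cases s) (simp add: ratfun_recip_Fract poly_subst_mult)

lemma ratfun_recip_to_fract: "ratfun_recip (to_fract p) = poly_subst p (1 / ratfun_z)"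
  by (simp add: to_fract_def ratfun_recip_Fract one_pCons)

lemma ratfun_recip_const [simp]: "ratfun_recip (ratfun_const c) = ratfun_const c"
  by (simp add: ratfun_const_def [of c] ratfun_recip_to_fract)

interpretation ratfun_recip: field_hom ratfun_recip
  using ratfun_recip_const [of 0] ratfun_recip_const [of 1]
  by unfold_locales (simp_all add: ratfun_recip_add ratfun_recip_mult)

lemma ratfun_recip_z: "ratfun_recip ratfun_z = 1 / ratfun_z"
  by (simp add: ratfun_z_def ratfun_recip_to_fract)

lemma ratfun_recip_poly_subst: "ratfun_recip (poly_subst p x) = poly_subst p (ratfun_recip x)"
  by (induction p) (simp_all add: ratfun_recip_add ratfun_recip_mult)

text \<open>The second application moves inside \<open>poly_subst\<close> and turns the point
  \<open>1 / ratfun_z\<close> back into \<open>ratfun_z\<close>, where substitution is the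
  identity.\<close>

lemma ratfun_recip_recip [simp]: "ratfun_recip (ratfun_recip r) = r"
  by (cases r)
    (simp add: ratfun_recip_Fract ratfun_recip.hom_div ratfun_recip_to_fract
      ratfun_recip_poly_subst ratfun_recip_z poly_subst_z Fract_conv_to_fract)

lemma map_poly_cnj_add: "map_poly cnj (p + q) = map_poly cnj p + map_poly cnj q"
  by (intro poly_eqI) (simp add: coeff_map_poly)

interpretation ratfun_cnj: field_hom ratfun_cnj
proof unfold_locales
  show "ratfun_cnj 0 = 0" "ratfun_cnj 1 = 1"
    by (simp_all add: Zero_fract_def One_fract_def ratfun_cnj_Fract one_pCons map_poly_pCons)
next
  fix r s
  show "ratfun_cnj (r + s) = ratfun_cnj r + ratfun_cnj s"
    by (cases r; cases s)
      (simp add: ratfun_cnj_Fract map_poly_cnj_add map_poly_cnj_mult map_poly_eq_0_iff)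
  show "ratfun_cnj (r * s) = ratfun_cnj r * ratfun_cnj s"
    by (cases r; cases s) (simp add: ratfun_cnj_Fract map_poly_cnj_mult)
qed

text \<open>This is the operation written \<open>R\<^sup>\<sharp>\<close> above.\<close>

definition para_adjoint :: "ratfun mat \<Rightarrow> ratfun mat" where
  "para_adjoint R = mat_recip (star R)"

lemma para_adjoint_dim [simp]:
  "dim_row (para_adjoint R) = dim_col R" "dim_col (para_adjoint R) = dim_row R"
  by (simp_all add: para_adjoint_def mat_recip_def star_def)

lemma para_adjoint_carrier [simp]: "R \<in> carrier_mat m n \<Longrightarrow> para_adjoint R \<in> carrier_mat n m"
  by (intro carrier_matI) auto

lemma para_adjoint_index [simp]:
  "i < dim_col R \<Longrightarrow> j < dim_row R \<Longrightarrow>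
    para_adjoint R $$ (i, j) = ratfun_recip (ratfun_cnj (R $$ (j, i)))"
  by (simp add: para_adjoint_def mat_recip_def star_def)

lemma para_adjoint_add:
  assumes "R \<in> carrier_mat m n" "S \<in> carrier_mat m n"
  shows "para_adjoint (R + S) = para_adjoint R + para_adjoint S"
  using assms by (intro eq_matI) (auto simp: ratfun_cnj.hom_add ratfun_recip.hom_add)

text \<open>Only the transposition reverses the factors; conjugation and substitution are field
  homomorphisms and pass through matrix products.\<close>

lemma para_adjoint_mult:
  assumes "R \<in> carrier_mat m n" "S \<in> carrier_mat n k"
  shows "para_adjoint (R * S) = para_adjoint S * para_adjoint R"
  using assms
  by (simp add: para_adjoint_def mat_recip_def star_def transpose_mult [OF assms]
      ratfun_cnj.mat_hom_mult [of _ k n _ m] ratfun_recip.mat_hom_mult [of _ k n _ m])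

lemma para_adjoint_one [simp]: "para_adjoint (1\<^sub>m n) = 1\<^sub>m n"
  by (intro eq_matI) auto

lemma para_adjoint_four_block_mat:
  assumes "A \<in> carrier_mat p p" "B \<in> carrier_mat p m" "C \<in> carrier_mat m p" "D \<in> carrier_mat m m"
  shows "para_adjoint (four_block_mat A B C D) =
    four_block_mat (para_adjoint A) (para_adjoint C) (para_adjoint B) (para_adjoint D)"
  using assms by (intro eq_matI) auto

text \<open>Both partitions have the same sizes, so a given entry lies in the same block on either
  side; shifting the row by \<open>p\<close> or the column by \<open>q\<close> selects the
  block.\<close>

lemma four_block_mat_inj:
  assumes A: "A \<in> carrier_mat p q" "A' \<in> carrier_mat p q"
    and B: "B \<in> carrier_mat p n" "B' \<in> carrier_mat p n"
    and C: "C \<in> carrier_mat m q" "C' \<in> carrier_mat m q"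
    and D: "D \<in> carrier_mat m n" "D' \<in> carrier_mat m n"
    and eq: "four_block_mat A B C D = four_block_mat A' B' C' D'"
  shows "A = A'" "B = B'" "C = C'" "D = D'"
proof -
  have entry: "four_block_mat A B C D $$ (i, j) = four_block_mat A' B' C' D' $$ (i, j)" for i j
    by (simp only: eq)
  show "A = A'"
  proof (intro eq_matI)
    fix i j assume "i < dim_row A'" "j < dim_col A'"
    then show "A $$ (i, j) = A' $$ (i, j)" using entry [of i j] A D by simp
  qed (use A in auto)
  show "B = B'"
  proof (intro eq_matI)
    fix i j assume "i < dim_row B'" "j < dim_col B'"
    then show "B $$ (i, j) = B' $$ (i, j)" using entry [of i "q + j"] A B C D by simp
  qed (use B in auto)
  show "C = C'"
  proof (intro eq_matI)
    fix i j assume "i < dim_row C'" "j < dim_col C'"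
    then show "C $$ (i, j) = C' $$ (i, j)" using entry [of "p + i" j] A B C D by simp
  qed (use C in auto)
  show "D = D'"
  proof (intro eq_matI)
    fix i j assume "i < dim_row D'" "j < dim_col D'"
    then show "D $$ (i, j) = D' $$ (i, j)" using entry [of "p + i" "q + j"] A B C D by simp
  qed (use D in auto)
qed

lemma para_adjoint_uminus: "para_adjoint (- R) = - para_adjoint R"
  by (intro eq_matI) (auto simp: ratfun_cnj.hom_uminus ratfun_recip.hom_uminus)

lemma rev1_star: "rev1 (star R) = ratfun_z \<cdot>\<^sub>m para_adjoint R"
  by (simp add: rev1_def para_adjoint_def)

text \<open>The hypothesis replaces \<open>star R\<close> by \<open>mat_recip R\<close>, and the
  outer \<open>mat_recip\<close> then undoes the inner one.\<close>

lemma para_adjoint_para_hermitian: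
  assumes "para_hermitian R"
  shows "para_adjoint R = R"
  using assms unfolding para_hermitian_def para_adjoint_def
  by (auto simp: mat_recip_def intro!: eq_matI)

lemma para_adjoint_para_skew_hermitian:
  assumes "para_skew_hermitian R"
  shows "para_adjoint R = - R"
  using assms unfolding para_skew_hermitian_def para_adjoint_def
  by (auto simp: mat_recip_def ratfun_recip.hom_uminus intro!: eq_matI)

text \<open>The adjoint of \<open>C\<close> lands where \<open>B\<close> stood and vice versa, hence
  the crossed equations. The sign in front of \<open>A\<close> occurs on both sides and
  cancels.\<close>

lemma para_adjoint_system_matrix_blocks:
  assumes carr: "A \<in> carrier_mat p p" "B \<in> carrier_mat p m" "C \<in> carrier_mat m p"
      "D \<in> carrier_mat m m"
    and eq: "para_adjoint (system_matrix A B C D) = w \<cdot>\<^sub>m system_matrix A B C D"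
  shows "para_adjoint A = w \<cdot>\<^sub>m A" "para_adjoint B = w \<cdot>\<^sub>m C"
    "para_adjoint C = w \<cdot>\<^sub>m B" "para_adjoint D = w \<cdot>\<^sub>m D"
proof -
  have blocks: "four_block_mat (- para_adjoint A) (para_adjoint C) (para_adjoint B) (para_adjoint D)
      = four_block_mat (w \<cdot>\<^sub>m - A) (w \<cdot>\<^sub>m B) (w \<cdot>\<^sub>m C) (w \<cdot>\<^sub>m D)"
    using eq carr
    by (simp add: system_matrix_def para_adjoint_four_block_mat [of _ p _ m] para_adjoint_uminus
        smult_four_block_mat [of _ p p _ m _ m])
  note inj = four_block_mat_inj [OF _ _ _ _ _ _ _ _ blocks, of p p m m]
  show "para_adjoint B = w \<cdot>\<^sub>m C" "para_adjoint C = w \<cdot>\<^sub>m B" "para_adjoint D = w \<cdot>\<^sub>m D"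
    by (rule inj; use carr in simp)+
  have "- para_adjoint A = w \<cdot>\<^sub>m - A"
    by (rule inj; use carr in simp)
  then have "- (- para_adjoint A) = - (w \<cdot>\<^sub>m - A)" by simp
  also have "- (w \<cdot>\<^sub>m - A) = w \<cdot>\<^sub>m A" by (intro eq_matI) auto
  finally show "para_adjoint A = w \<cdot>\<^sub>m A" by (simp add: uminus_uminus_mat)
qed

lemma para_adjoint_transfer_function:
  assumes lsm: "linear_system_matrix p m m A B C D" and "w \<noteq> 0"
    and eq: "para_adjoint (system_matrix A B C D) = w \<cdot>\<^sub>m system_matrix A B C D"
  shows "para_adjoint (transfer_function A B C D) = w \<cdot>\<^sub>m transfer_function A B C D"
proof -
  have A: "A \<in> carrier_mat p p" and B: "B \<in> carrier_mat p m" and C: "C \<in> carrier_mat m p"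
    and D: "D \<in> carrier_mat m m" and det: "det A \<noteq> 0"
    using lsm by (auto simp: linear_system_matrix_def)
  note blocks = para_adjoint_system_matrix_blocks [OF A B C D eq]
  define X where "X = the (mat_inverse A)"
  have X: "X \<in> carrier_mat p p" and AX: "A * X = 1\<^sub>m p"
    using mat_inverse_regular [OF A det] by (auto simp: X_def)
  have X': "para_adjoint X \<in> carrier_mat p p" using X by simp
  \<comment> \<open>Taking adjoints in \<open>A * X = 1\<^sub>m p\<close> makes
    \<open>w \<cdot>\<^sub>m para_adjoint X\<close> a left inverse of \<open>A\<close>. It therefore
    equals the right inverse \<open>X\<close>.\<close>
  have "para_adjoint X * (w \<cdot>\<^sub>m A) = para_adjoint (A * X)"
    by (simp add: para_adjoint_mult [OF A X] blocks)
  then have XA: "w \<cdot>\<^sub>m (para_adjoint X * A) = 1\<^sub>m p"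
    by (simp add: AX mult_smult_distrib [OF X' A])
  have "w \<cdot>\<^sub>m para_adjoint X = w \<cdot>\<^sub>m (para_adjoint X * A * X)"
    using assoc_mult_mat [OF X' A X] right_mult_one_mat [OF X'] by (simp add: AX)
  also have "\<dots> = w \<cdot>\<^sub>m (para_adjoint X * A) * X"
    by (rule mult_smult_assoc_mat [symmetric, OF mult_carrier_mat [OF X' A] X])
  also have "\<dots> = X" using X by (simp add: XA)
  finally have wX: "w \<cdot>\<^sub>m para_adjoint X = X" .
  have CX: "C * X \<in> carrier_mat m p" using C X by simp
  have "para_adjoint (C * X * B) = w \<cdot>\<^sub>m C * (para_adjoint X * (w \<cdot>\<^sub>m B))"
    by (simp add: para_adjoint_mult [OF CX B] para_adjoint_mult [OF C X] blocks)
  \<comment> \<open>The factor \<open>w\<close> coming from \<open>B\<close> is absorbed in turning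
    \<open>para_adjoint X\<close> into \<open>X\<close>; the one at \<open>C\<close>
    survives.\<close>
  also have "para_adjoint X * (w \<cdot>\<^sub>m B) = X * B"
    using mult_smult_distrib [OF X' B, of w] mult_smult_assoc_mat [OF X' B, of w] wX by simp
  also have "w \<cdot>\<^sub>m C * (X * B) = w \<cdot>\<^sub>m (C * X * B)"
    using assoc_mult_mat [OF C X B] mult_smult_assoc_mat [OF C mult_carrier_mat [OF X B]] by simp
  finally have "para_adjoint (C * X * B) = w \<cdot>\<^sub>m (C * X * B)" .
  moreover have "C * X * B \<in> carrier_mat m m" using CX B by simp
  ultimately show ?thesis
    using D by (simp add: transfer_function_def X_def [symmetric] para_adjoint_add blocks
        add_smult_distrib_left_mat [of _ m m])
qed

lemma ratfun_z_neq_1: "ratfun_z \<noteq> 1"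
  by (simp add: ratfun_z_def one_pCons flip: to_fract_1)

lemma eq_smult_mat_imp_zero:
  fixes R :: "'a :: field mat"
  assumes "R \<in> carrier_mat m n" and "c \<cdot>\<^sub>m R = d \<cdot>\<^sub>m R" and "c \<noteq> d"
  shows "R = 0\<^sub>m m n"
  using assms by (auto simp: mat_eq_iff)

theorem corollary3p2:
  fixes F :: "complex set" and m :: nat and R :: "complex poly fract mat"
  assumes "F = \<real> \<or> F = UNIV"
    and "R \<in> carrier_mat m m"
    and "elements_mat R \<subseteq> ratfuns_over F"
    and "R \<noteq> 0\<^sub>m m m"
  shows "(para_hermitian R \<longrightarrow>
            (\<nexists>p A B C D. linear_system_matrix p m m A B C D \<and>
               star_palindromic (system_matrix A B C D) \<and> transfer_function A B C D = R)) \<and>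
         (para_skew_hermitian R \<longrightarrow>
            (\<nexists>p A B C D. linear_system_matrix p m m A B C D \<and>
               star_anti_palindromic (system_matrix A B C D) \<and> transfer_function A B C D = R))"
proof -
  \<comment> \<open>The sign \<open>e\<close> is \<open>1\<close> in the Hermitian case and
    \<open>- 1\<close> in the skew case, so one argument serves both.\<close>
  have contr: False
    if e: "e \<noteq> 0" and adj: "para_adjoint R = e \<cdot>\<^sub>m R"
      and lsm: "linear_system_matrix p m m A B C D"
      and rev: "rev1 (star (system_matrix A B C D)) = e \<cdot>\<^sub>m system_matrix A B C D"
      and tf: "transfer_function A B C D = R"
    for e p A B C D
  proof -
    let ?L = "system_matrix A B C D"
    \<comment> \<open>The factor \<open>ratfun_z\<close> in \<open>rev1\<close> is divided out,
      which gives the scaling \<open>w = e / ratfun_z\<close> for the system matrix.\<close>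
    have "para_adjoint ?L = (1 / ratfun_z) \<cdot>\<^sub>m (ratfun_z \<cdot>\<^sub>m para_adjoint ?L)"
      by (intro eq_matI) auto
    also have "\<dots> = (e / ratfun_z) \<cdot>\<^sub>m ?L"
      unfolding rev1_star [symmetric] rev by (intro eq_matI) auto
    finally have "para_adjoint R = (e / ratfun_z) \<cdot>\<^sub>m R"
      using para_adjoint_transfer_function [OF lsm] e tf by simp
    then have "e \<cdot>\<^sub>m R = (e / ratfun_z) \<cdot>\<^sub>m R" using adj by simp
    \<comment> \<open>Two different scalars have the same effect on \<open>R\<close>, so their
      nonzero difference annihilates every entry of \<open>R\<close>.\<close>
    moreover have "e \<noteq> e / ratfun_z" using e ratfun_z_neq_1 by (simp add: field_simps)
    ultimately show False using eq_smult_mat_imp_zero assms(2,4) by blast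
  qed
  have one: "1 \<cdot>\<^sub>m M = M" and minus: "- 1 \<cdot>\<^sub>m M = - M" for M :: "ratfun mat"
    by (auto intro: eq_matI)
  have herm: False
    if "para_hermitian R" "linear_system_matrix p m m A B C D"
      "star_palindromic (system_matrix A B C D)" "transfer_function A B C D = R" for p A B C D
    using that contr [of 1 p A B C D] para_adjoint_para_hermitian [of R]
    by (simp add: one star_palindromic_def)
  have skew: False
    if "para_skew_hermitian R" "linear_system_matrix p m m A B C D"
      "star_anti_palindromic (system_matrix A B C D)" "transfer_function A B C D = R" for p A B C D
    using that contr [of "- 1" p A B C D] para_adjoint_para_skew_hermitian [of R]
    by (simp add: minus star_anti_palindromic_def)
  show ?thesis using herm skew by blast
qed

end
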